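(* Let $1\le q\le\alpha\le p\le\infty$. For any real number $r>0$, $\left((L^q,L^p)^\alpha_r(X),\ {}_{r}\|\cdot\|_{q,p,\alpha}\right)$ is a complex Banach space.
   Context: Setting. $(X,d,\mu)$ is a space of homogeneous type: $d$ is a quasi-metric on $X$ (with a constant $\kappa\ge 1$ such that $d(x,y)\le\kappa(d(x,z)+d(z,y))$ for all $x,y,z\in X$), and $\mu$ is a non-negative Borel measure such that, with $B(x,r)=\{y\in X: d(x,y)<r\}$, there is a constant $C$ with $0<\mu(B(x,2r))\le C\mu(B(x,r))<\infty$ for all $x\in X$, $r>0$. It is assumed moreover that all balls $B(x,r)$ are open for the $d$-topology, $(X,d)$ is separable, $\mu(X)=\infty$, and $B(x,R)\setminus B(x,r)\neq\emptyset$ for all $x\in X$ and $0<r<R<\infty$. Notation. $L_0(X)$ is the complex vector space of classes (modulo equality $\mu$-almost everywhere) of $\mu$-measurable complex-valued functions on $X$; $\|\cdot\|_q$ is the usual norm of $L^q(X)=L^q(X,\mu)$; $\chi_E$ is the characteristic function of $E$. For $f\in L_0(X)$ and $r>0$ (convention $1/\infty=0$), $${}_{r}\|f\|_{q,p,\alpha}=\left[\int_X\left(\mu(B(y,r))^{\frac1\alpha-\frac1p-\frac1q}\,\|f\chi_{B(y,r)}\|_q\right)^p d\mu(y)\right]^{1/p}\quad\text{if } p<\infty,$$ $${}_{r}\|f\|_{q,\infty,\alpha}=\sup_{y\in X}\mu(B(y,r))^{\frac1\alpha-\frac1q}\,\|f\chi_{B(y,r)}\|_q\quad\text{if } p=\infty,$$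 and $(L^q,L^p)^\alpha_r(X)=\{f\in L_0(X):\ {}_{r}\|f\|_{q,p,\alpha}<\infty\}$. *)

theory Defs
  imports
    "HOL-Analysis.Analysis"
    "HOL-Probability.Essential_Supremum"
    "HOL-Algebra.Module"
    "HOL-Algebra.Algebraic_Closure_Type"
begin

section \<open>Complex Banach spaces with an explicit carrier\<close>

text \<open>The underlying vector space is a module over the field of complex numbers; the
  multiplicative components of the record \<open>V\<close> play no role in \<^locale>\<open>module\<close>.\<close>

locale complex_normed_space = Module.module "ring_of_type_algebra :: complex ring" V
  for V :: "(complex, 'v) module" (structure) +
  fixes nrm :: "'v \<Rightarrow> real"
  assumes nrm_nonneg: "u \<in> carrier V \<Longrightarrow> 0 \<le> nrm u"
    and nrm_eq_0_iff: "u \<in> carrier V \<Longrightarrow> nrm u = 0 \<longleftrightarrow> u = \<zero>"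
    and nrm_smult: "u \<in> carrier V \<Longrightarrow> nrm (c \<odot> u) = cmod c * nrm u"
    and nrm_triangle: "u \<in> carrier V \<Longrightarrow> v \<in> carrier V \<Longrightarrow> nrm (u \<oplus> v) \<le> nrm u + nrm v"

text \<open>\<^locale>\<open>Metric_space\<close> asks for a nonnegative symmetric function on the whole type, hence the
  value 0 away from the carrier.\<close>

definition nrm_dist :: "('k, 'v) module \<Rightarrow> ('v \<Rightarrow> real) \<Rightarrow> 'v \<Rightarrow> 'v \<Rightarrow> real" where
  "nrm_dist V nrm u v =
     (if u \<in> carrier V \<and> v \<in> carrier V then nrm (u \<ominus>\<^bsub>V\<^esub> v) else 0)"

context complex_normed_space
begin

lemma smult_minus_one:
  assumes "u \<in> carrier V"
  shows "(- 1 :: complex) \<odot> u = \<ominus> u"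
proof -
  have "\<ominus>\<^bsub>(ring_of_type_algebra :: complex ring)\<^esub> \<one>\<^bsub>(ring_of_type_algebra :: complex ring)\<^esub> = - 1"
    by (rule R.minus_equality) (auto simp: ring_of_type_algebra_def)
  then show ?thesis
    using smult_l_minus[of "\<one>\<^bsub>(ring_of_type_algebra :: complex ring)\<^esub>" u] assms by simp
qed

lemma Metric_space_nrm_dist: "Metric_space (carrier V) (nrm_dist V nrm)"
proof
  fix u v
  show "0 \<le> nrm_dist V nrm u v"
    by (simp add: nrm_dist_def nrm_nonneg)
  show "nrm_dist V nrm u v = nrm_dist V nrm v u"
  proof (cases "u \<in> carrier V \<and> v \<in> carrier V")
    case True
    then have "v \<ominus> u = (- 1 :: complex) \<odot> (u \<ominus> v)"
      by (subst smult_minus_one) (auto simp: M.minus_add M.minus_eq M.a_comm)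
    then have "nrm (v \<ominus> u) = nrm (u \<ominus> v)"
      using True nrm_smult[of "u \<ominus> v" "- 1"] by simp
    with True show ?thesis
      by (simp add: nrm_dist_def)
  qed (auto simp: nrm_dist_def)
next
  fix u v assume uv: "u \<in> carrier V" "v \<in> carrier V"
  have "u \<ominus> v = \<zero> \<longleftrightarrow> u = v"
  proof
    assume "u \<ominus> v = \<zero>"
    then have "\<ominus> (\<ominus> v) = u"
      using uv by (intro M.minus_equality) (simp_all add: M.minus_eq)
    with uv show "u = v"
      by simp
  qed (use uv in \<open>simp add: M.minus_eq M.r_neg\<close>)
  with uv show "nrm_dist V nrm u v = 0 \<longleftrightarrow> u = v"
    by (simp add: nrm_dist_def nrm_eq_0_iff)
next
  fix u v w assume uvw: "u \<in> carrier V" "v \<in> carrier V" "w \<in> carrier V"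
  then have "u \<ominus> w = (u \<ominus> v) \<oplus> (v \<ominus> w)"
    by (simp add: M.minus_eq M.a_assoc M.r_neg1)
  with uvw show "nrm_dist V nrm u w \<le> nrm_dist V nrm u v + nrm_dist V nrm v w"
    using nrm_triangle[of "u \<ominus> v" "v \<ominus> w"] by (simp add: nrm_dist_def)
qed

end

locale complex_banach_space = complex_normed_space +
  assumes complete: "Metric_space.mcomplete (carrier V) (nrm_dist V nrm)"


section \<open>Spaces of homogeneous type\<close>

text \<open>The set \<open>X\<close> is the whole type \<open>'a\<close>.\<close>

locale quasi_metric =
  fixes d :: "'a \<Rightarrow> 'a \<Rightarrow> real"
  assumes nonneg: "0 \<le> d x y"
    and eq_0_iff: "d x y = 0 \<longleftrightarrow> x = y"
    and sym: "d x y = d y x"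
    and quasi_triangle: "\<exists>\<kappa>\<ge>1. \<forall>x y z. d x y \<le> \<kappa> * (d x z + d z y)"

definition qball :: "('a \<Rightarrow> 'a \<Rightarrow> real) \<Rightarrow> 'a \<Rightarrow> real \<Rightarrow> 'a set" where
  "qball d x r = {y. d x y < r}"

definition d_topology :: "('a \<Rightarrow> 'a \<Rightarrow> real) \<Rightarrow> 'a topology" where
  "d_topology d = topology (\<lambda>U. \<forall>x\<in>U. \<exists>r>0. qball d x r \<subseteq> U)"

lemma openin_d_topology:
  "openin (d_topology d) U \<longleftrightarrow> (\<forall>x\<in>U. \<exists>r>0. qball d x r \<subseteq> U)"
proof -
  have "istopology (\<lambda>U. \<forall>x\<in>U. \<exists>r>0. qball d x r \<subseteq> U)"
    unfolding istopology_def
  proof (intro conjI allI impI ballI)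
    fix S T x
    assume S: "\<forall>x\<in>S. \<exists>r>0. qball d x r \<subseteq> S" and T: "\<forall>x\<in>T. \<exists>r>0. qball d x r \<subseteq> T"
      and x: "x \<in> S \<inter> T"
    then obtain r s where rs: "r > 0" "qball d x r \<subseteq> S" "s > 0" "qball d x s \<subseteq> T"
      by blast
    then have "qball d x (min r s) \<subseteq> S \<inter> T"
      by (auto simp: qball_def)
    with rs show "\<exists>r>0. qball d x r \<subseteq> S \<inter> T"
      by (intro exI[of _ "min r s"]) auto
  qed (meson Union_upper UnionE order_trans)
  then show ?thesis
    by (simp add: d_topology_def topology_inverse')
qed

text \<open>The measure lives on any \<open>\<sigma>\<close>-algebra containing the Borel sets of the \<open>d\<close>-topology, so
  that it may be either the Borel \<open>\<sigma>\<close>-algebra itself or its completion.\<close>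

locale homogeneous_space = quasi_metric d
  for d :: "'a \<Rightarrow> 'a \<Rightarrow> real" +
  fixes \<mu> :: "'a measure"
  assumes space_UNIV: "space \<mu> = UNIV"
    and borel: "openin (d_topology d) U \<Longrightarrow> U \<in> sets \<mu>"
    and doubling: "\<exists>C::real. \<forall>x. \<forall>r>0.
          0 < emeasure \<mu> (qball d x (2 * r)) \<and>
          emeasure \<mu> (qball d x (2 * r)) \<le> ennreal C * emeasure \<mu> (qball d x r) \<and>
          ennreal C * emeasure \<mu> (qball d x r) < \<infinity>"
    and balls_open: "openin (d_topology d) (qball d x r)"
    and separable: "separable_space (d_topology d)"
    and infinite_measure: "emeasure \<mu> UNIV = \<infinity>"
    and annuli_nonempty: "0 < r \<Longrightarrow> r < R \<Longrightarrow> qball d x R - qball d x r \<noteq> {}"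


section \<open>The space of classes of measurable functions\<close>

definition ae_rel :: "'a measure \<Rightarrow> (('a \<Rightarrow> complex) \<times> ('a \<Rightarrow> complex)) set" where
  "ae_rel \<mu> = {(f, g). f \<in> borel_measurable \<mu> \<and> g \<in> borel_measurable \<mu> \<and> (AE x in \<mu>. f x = g x)}"

definition L0 :: "'a measure \<Rightarrow> (complex, ('a \<Rightarrow> complex) set) module" where
  "L0 \<mu> =
    \<lparr>carrier = borel_measurable \<mu> // ae_rel \<mu>,
     monoid.mult = (\<lambda>F G. \<Union>f\<in>F. \<Union>g\<in>G. ae_rel \<mu> `` {\<lambda>x. f x * g x}),
     one = ae_rel \<mu> `` {\<lambda>x. 1},
     ring.zero = ae_rel \<mu> `` {\<lambda>x. 0},
     add = (\<lambda>F G. \<Union>f\<in>F. \<Union>g\<in>G. ae_rel \<mu> `` {\<lambda>x. f x + g x}),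
     smult = (\<lambda>c F. \<Union>f\<in>F. ae_rel \<mu> `` {\<lambda>x. c * f x})\<rparr>"


section \<open>The amalgam norms\<close>

text \<open>Exponents are extended nonnegative reals; \<open>recip s\<close> is \<open>1/s\<close> with \<open>1/\<infinity> = 0\<close>.\<close>

definition recip :: "ennreal \<Rightarrow> real" where
  "recip s = enn2real (1 / s)"

text \<open>Only used for exponents \<open>s > 0\<close>, where \<open>\<infinity>\<close> to the power \<open>s\<close> is \<open>\<infinity>\<close>.\<close>

definition ennpowr :: "ennreal \<Rightarrow> real \<Rightarrow> ennreal" where
  "ennpowr x s = (if x = \<infinity> then \<infinity> else ennreal (enn2real x powr s))"

definition Lq_norm :: "'a measure \<Rightarrow> ennreal \<Rightarrow> ('a \<Rightarrow> complex) \<Rightarrow> ennreal" where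
  "Lq_norm \<mu> q f =
    (if q = \<infinity> then esssup \<mu> (\<lambda>x. ennreal (cmod (f x)))
     else ennpowr (\<integral>\<^sup>+x. ennpowr (ennreal (cmod (f x))) (enn2real q) \<partial>\<mu>) (recip q))"

definition local_norm ::
  "('a \<Rightarrow> 'a \<Rightarrow> real) \<Rightarrow> 'a measure \<Rightarrow> ennreal \<Rightarrow> ennreal \<Rightarrow> ennreal \<Rightarrow> real \<Rightarrow>
    ('a \<Rightarrow> complex) \<Rightarrow> 'a \<Rightarrow> ennreal" where
  "local_norm d \<mu> q p \<alpha> r f y =
     ennreal (measure \<mu> (qball d y r) powr (recip \<alpha> - recip p - recip q)) *
     Lq_norm \<mu> q (\<lambda>x. f x * indicator (qball d y r) x)"

definition amalgam_norm ::
  "('a \<Rightarrow> 'a \<Rightarrow> real) \<Rightarrow> 'a measure \<Rightarrow> ennreal \<Rightarrow> ennreal \<Rightarrow> ennreal \<Rightarrow> real \<Rightarrow>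
    ('a \<Rightarrow> complex) \<Rightarrow> ennreal" where
  "amalgam_norm d \<mu> q p \<alpha> r f =
    (if p = \<infinity> then (SUP y. local_norm d \<mu> q p \<alpha> r f y)
     else ennpowr (\<integral>\<^sup>+y. ennpowr (local_norm d \<mu> q p \<alpha> r f y) (enn2real p) \<partial>\<mu>) (recip p))"

lemma Lq_norm_cong_AE:
  assumes "f \<in> borel_measurable \<mu>" "g \<in> borel_measurable \<mu>" "AE x in \<mu>. f x = g x"
  shows "Lq_norm \<mu> q f = Lq_norm \<mu> q g"
proof -
  have [measurable]: "f \<in> borel_measurable \<mu>" "g \<in> borel_measurable \<mu>"
    using assms by auto
  have "(AE x in \<mu>. ennreal (cmod (f x)) \<le> z) \<longleftrightarrow> (AE x in \<mu>. ennreal (cmod (g x)) \<le> z)" for z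
    by (rule eventually_subst, rule eventually_mono[OF assms(3)], simp)
  then have 1: "esssup \<mu> (\<lambda>x. ennreal (cmod (f x))) = esssup \<mu> (\<lambda>x. ennreal (cmod (g x)))"
    by (simp add: esssup_eq_AE)
  have 2: "(\<integral>\<^sup>+x. ennpowr (ennreal (cmod (f x))) (enn2real q) \<partial>\<mu>) =
        (\<integral>\<^sup>+x. ennpowr (ennreal (cmod (g x))) (enn2real q) \<partial>\<mu>)"
    using assms by (intro nn_integral_cong_AE) auto
  show ?thesis
    unfolding Lq_norm_def 1 2 ..
qed

lemma (in homogeneous_space) amalgam_norm_cong:
  assumes "(f, g) \<in> ae_rel \<mu>"
  shows "amalgam_norm d \<mu> q p \<alpha> r f = amalgam_norm d \<mu> q p \<alpha> r g"
proof -
  have "local_norm d \<mu> q p \<alpha> r f = local_norm d \<mu> q p \<alpha> r g"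
  proof
    fix y
    have [measurable]: "qball d y r \<in> sets \<mu>"
      by (intro borel balls_open)
    have [measurable]: "f \<in> borel_measurable \<mu>" "g \<in> borel_measurable \<mu>"
      and ae: "AE x in \<mu>. f x = g x"
      using assms by (auto simp: ae_rel_def)
    have "Lq_norm \<mu> q (\<lambda>x. f x * indicator (qball d y r) x) =
          Lq_norm \<mu> q (\<lambda>x. g x * indicator (qball d y r) x)"
      using ae by (intro Lq_norm_cong_AE) auto
    then show "local_norm d \<mu> q p \<alpha> r f y = local_norm d \<mu> q p \<alpha> r g y"
      by (simp add: local_norm_def)
  qed
  then show ?thesis
    unfolding amalgam_norm_def by (simp only:)
qed

definition amalgam_class_norm ::
  "('a \<Rightarrow> 'a \<Rightarrow> real) \<Rightarrow> 'a measure \<Rightarrow> ennreal \<Rightarrow> ennreal \<Rightarrow> ennreal \<Rightarrow> real \<Rightarrow>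
    ('a \<Rightarrow> complex) set \<Rightarrow> ennreal" where
  "amalgam_class_norm d \<mu> q p \<alpha> r F = the_elem (amalgam_norm d \<mu> q p \<alpha> r ` F)"

lemma (in homogeneous_space) amalgam_class_norm_class:
  assumes "f \<in> borel_measurable \<mu>"
  shows "amalgam_class_norm d \<mu> q p \<alpha> r (ae_rel \<mu> `` {f}) = amalgam_norm d \<mu> q p \<alpha> r f"
proof -
  have "f \<in> ae_rel \<mu> `` {f}"
    using assms by (simp add: ae_rel_def)
  moreover have "amalgam_norm d \<mu> q p \<alpha> r g = amalgam_norm d \<mu> q p \<alpha> r f" if "g \<in> ae_rel \<mu> `` {f}" for g
    using amalgam_norm_cong[of f g] that by simp
  ultimately have "amalgam_norm d \<mu> q p \<alpha> r ` (ae_rel \<mu> `` {f}) = {amalgam_norm d \<mu> q p \<alpha> r f}"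
    by blast
  then show ?thesis
    by (simp add: amalgam_class_norm_def)
qed

definition amalgam_space ::
  "('a \<Rightarrow> 'a \<Rightarrow> real) \<Rightarrow> 'a measure \<Rightarrow> ennreal \<Rightarrow> ennreal \<Rightarrow> ennreal \<Rightarrow> real \<Rightarrow>
    (complex, ('a \<Rightarrow> complex) set) module" where
  "amalgam_space d \<mu> q p \<alpha> r =
    (L0 \<mu>)\<lparr>carrier := {F \<in> carrier (L0 \<mu>). amalgam_class_norm d \<mu> q p \<alpha> r F < \<infinity>}\<rparr>"

end

theory Submission
  imports Defs
begin

text \<open>
  The amalgam norm of \<open>f\<close> depends only on \<open>|f|\<close>. It is an outer norm (\<open>L\<^sup>p\<close>, or the supremum over all
  centres) of the function sending a centre \<open>y\<close> to a positive weight times the \<open>L\<^sup>q\<close> norm of \<open>|f|\<close> on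
  \<open>B(y, r)\<close>. Completeness is a general property of functionals on nonnegative measurable functions that
  are monotone, homogeneous, subadditive and definite, respect equality almost everywhere and
  satisfy monotone convergence. The proof of the Riesz--Fischer theorem uses nothing else
  (\<open>Cauchy_imp_convergent\<close>, \<open>complex_banach_space_function_space\<close>). These properties hold for \<open>L\<^sup>q\<close>
  norms with \<open>q \<ge> 1\<close>, including Minkowski's inequality, which is derived from the convexity of powers
  (\<open>banach_function_norm_L_norm\<close>), and they survive the composition of the outer and the local norms
  (\<open>banach_function_norm_averages_over_balls\<close>).

  The geometry of the space enters in two places. The outer integral is additive only on measurable
  functions, so the local norms must be measurable in the centre. Since balls are open, integrals over
  \<open>B(y, r)\<close> are lower semicontinuous in \<open>y\<close> (\<open>openin_integral_over_ball_greater\<close>), and the measure of the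
  ball and the local norms are obtained from such integrals. For definiteness, a function
  whose local norm vanishes at almost every centre must vanish almost everywhere; this holds because
  separability and the positive measure of balls allow the space to be covered by countably many
  balls with centres in any set of full measure (\<open>countable_ball_cover\<close>).
\<close>

section \<open>Powers of extended nonnegative reals\<close>

lemma ennpowr_top [simp]: "ennpowr \<infinity> s = \<infinity>" "ennpowr Orderings.top s = Orderings.top"
  by (simp_all add: ennpowr_def)

lemma ennpowr_ennreal: "0 \<le> x \<Longrightarrow> ennpowr (ennreal x) s = ennreal (x powr s)"
  by (simp add: ennpowr_def)

lemma ennpowr_zero [simp]: "ennpowr 0 s = 0"
  by (simp add: ennpowr_def)

lemma ennpowr_ennpowr_inverse:
  assumes "0 < s"
  shows "ennpowr (ennpowr x s) (1 / s) = x"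
  using assms by (cases x) (auto simp: ennpowr_ennreal powr_powr)

lemma ennpowr_mono:
  assumes "0 < s" "x \<le> y"
  shows "ennpowr x s \<le> ennpowr y s"
  using assms by (cases x; cases y) (auto simp: ennpowr_ennreal powr_mono2 top_unique)

text \<open>For \<open>s > 0\<close> the \<open>s\<close>-th power is an order isomorphism of \<open>[0, \<infinity>]\<close> whose inverse is the power with
  exponent \<open>1 / s\<close>. This adjunction is what makes it commute with suprema and turns a bound on an
  \<open>L\<^sup>s\<close> norm into a bound on an integral.\<close>

lemma ennpowr_le_iff:
  assumes "0 < s"
  shows "ennpowr x s \<le> y \<longleftrightarrow> x \<le> ennpowr y (1 / s)"
proof
  assume "ennpowr x s \<le> y"
  then have "ennpowr (ennpowr x s) (1 / s) \<le> ennpowr y (1 / s)"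
    using assms by (intro ennpowr_mono) auto
  then show "x \<le> ennpowr y (1 / s)"
    using assms by (simp add: ennpowr_ennpowr_inverse)
next
  assume "x \<le> ennpowr y (1 / s)"
  then have "ennpowr x s \<le> ennpowr (ennpowr y (1 / s)) (1 / (1 / s))"
    using ennpowr_mono[OF assms] by simp
  then show "ennpowr x s \<le> y"
    using assms ennpowr_ennpowr_inverse[of "1 / s" y] by simp
qed

lemma ennpowr_root_le_iff: "0 < s \<Longrightarrow> ennpowr x (1 / s) \<le> y \<longleftrightarrow> x \<le> ennpowr y s"
  using ennpowr_le_iff[of "1 / s" x y] by simp

lemma ennpowr_eq_0_iff: "0 < s \<Longrightarrow> ennpowr x s = 0 \<longleftrightarrow> x = 0"
  using ennpowr_le_iff[of s x 0] by simp

lemma ennpowr_SUP: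
  assumes "0 < s"
  shows "ennpowr (SUP n\<in>A. f n) s = (SUP n\<in>A. ennpowr (f n) s)"
proof (rule antisym)
  have "f n \<le> ennpowr (SUP n\<in>A. ennpowr (f n) s) (1 / s)" if "n \<in> A" for n
    unfolding ennpowr_le_iff[OF assms, symmetric] by (rule SUP_upper) (rule that)
  then show "ennpowr (SUP n\<in>A. f n) s \<le> (SUP n\<in>A. ennpowr (f n) s)"
    unfolding ennpowr_le_iff[OF assms] by (rule SUP_least)
  show "(SUP n\<in>A. ennpowr (f n) s) \<le> ennpowr (SUP n\<in>A. f n) s"
    by (intro SUP_least ennpowr_mono assms SUP_upper)
qed

lemma ennpowr_mult:
  assumes "0 < s"
  shows "ennpowr (x * y) s = ennpowr x s * ennpowr y s"
proof (cases "x = 0 \<or> y = 0")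
  case False
  with assms show ?thesis
    by (cases x; cases y)
      (auto simp: ennpowr_ennreal powr_mult ennreal_mult[symmetric] ennreal_mult_top ennreal_top_mult)
qed (use assms in auto)

lemma measurable_ennpowr [measurable]:
  assumes [measurable]: "h \<in> borel_measurable M"
  shows "(\<lambda>x. ennpowr (h x) s) \<in> borel_measurable M"
  unfolding ennpowr_def by measurable

text \<open>\<open>powr_convex\<close> concerns the open half line; at the endpoint \<open>0\<close> the inequality reduces to
  \<open>t\<^sup>s \<le> t\<close>.\<close>

lemma powr_convex_nonneg:
  fixes x y t s :: real
  assumes s: "1 \<le> s" and xy: "0 \<le> x" "0 \<le> y" and t: "0 \<le> t" "t \<le> 1"
  shows "((1 - t) * x + t * y) powr s \<le> (1 - t) * x powr s + t * y powr s"
proof -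
  have le: "u powr s \<le> u" if "0 \<le> u" "u \<le> 1" for u :: real
    using powr_mono'[of 1 s u] that s by (cases "u = 0") auto
  show ?thesis
  proof (cases "x = 0 \<or> y = 0")
    case True
    then show ?thesis
      using le[of t] le[of "1 - t"] t xy s by (auto simp: powr_mult mult_right_mono)
  next
    case False
    then show ?thesis
      using convex_onD[OF powr_convex[OF s], of t x y] t xy by simp
  qed
qed

text \<open>Convexity of \<open>u \<mapsto> u\<^sup>s\<close> applied to
  \<open>(x + y) / (a + b) = a / (a + b) \<cdot> (x / a) + b / (a + b) \<cdot> (y / b)\<close>, with the denominators cleared. If \<open>x\<close> and
  \<open>y\<close> run through two functions whose \<open>L\<^sup>s\<close> norms are at most \<open>a\<close> and \<open>b\<close>, the integral of the right-hand
  side is at most \<open>(a + b)\<^sup>s\<close>, which is Minkowski's inequality.\<close>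

lemma ennpowr_convex:
  fixes a b s :: real
  assumes s: "1 \<le> s" and ab: "0 < a" "0 < b"
  shows "ennpowr (x + y) s \<le> ennreal ((a + b) powr s) *
    (ennreal (a / (a + b) / a powr s) * ennpowr x s + ennreal (b / (a + b) / b powr s) * ennpowr y s)"
proof (cases "x = \<infinity> \<or> y = \<infinity>")
  case True
  moreover have "0 < a / (a + b) / a powr s" "0 < b / (a + b) / b powr s" "0 < (a + b) powr s"
    using ab by auto
  ultimately show ?thesis
    by (auto simp: ennreal_mult_top)
next
  case False
  then obtain u v where uv: "x = ennreal u" "y = ennreal v" "0 \<le> u" "0 \<le> v"
    by (metis ennreal_cases infinity_ennreal_def)
  define t where "t = b / (a + b)"
  have t: "0 \<le> t" "t \<le> 1" "1 - t = a / (a + b)"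
    using ab by (auto simp: t_def field_simps)
  have "u + v = (a + b) * ((1 - t) * (u / a) + t * (v / b))"
  proof -
    have "(1 - t) * (u / a) = u / (a + b)" "t * (v / b) = v / (a + b)"
      using ab by (simp_all only: t(3)) (simp_all add: t_def)
    then show ?thesis
      using ab by (simp flip: add_divide_distrib)
  qed
  then have "(u + v) powr s = (a + b) powr s * ((1 - t) * (u / a) + t * (v / b)) powr s"
    using uv ab t by (simp add: powr_mult)
  also have "((1 - t) * (u / a) + t * (v / b)) powr s \<le> (1 - t) * (u / a) powr s + t * (v / b) powr s"
    using powr_convex_nonneg[OF s, of "u / a" "v / b" t] t uv ab by simp
  also have "\<dots> = a / (a + b) / a powr s * u powr s + b / (a + b) / b powr s * v powr s"
    using uv ab by (simp only: t(3)) (simp add: t_def powr_divide)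
  finally have "(u + v) powr s \<le> (a + b) powr s *
      (a / (a + b) / a powr s * u powr s + b / (a + b) / b powr s * v powr s)"
    using ab by simp
  then show ?thesis
    using uv ab
    by (simp add: ennpowr_ennreal flip: ennreal_plus ennreal_mult)
qed

section \<open>Norms on nonnegative measurable functions\<close>

text \<open>Norms are treated as functionals on \<open>[0, \<infinity>]\<close>-valued functions, so that infinite series of
  absolute values and suprema of sequences can be measured before anything is known to be finite.
  Monotonicity is pointwise everywhere, and invariance under changes on null sets is a separate
  requirement, because the supremum over all points satisfies the former but not the latter.\<close>

locale function_norm =
  fixes M :: "'a measure" and \<rho> :: "('a \<Rightarrow> ennreal) \<Rightarrow> ennreal"
  assumes mono: "h \<in> borel_measurable M \<Longrightarrow> k \<in> borel_measurable M \<Longrightarrow> (\<And>x. h x \<le> k x) \<Longrightarrow> \<rho> h \<le> \<rho> k"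
    and scale: "h \<in> borel_measurable M \<Longrightarrow> \<rho> (\<lambda>x. ennreal c * h x) = ennreal c * \<rho> h"
    and triangle: "h \<in> borel_measurable M \<Longrightarrow> k \<in> borel_measurable M \<Longrightarrow>
      \<rho> (\<lambda>x. h x + k x) \<le> \<rho> h + \<rho> k"
    and monotone_convergence: "(\<And>n::nat. hh n \<in> borel_measurable M) \<Longrightarrow> incseq hh \<Longrightarrow>
      \<rho> (\<lambda>x. SUP n. hh n x) \<le> (SUP n. \<rho> (hh n))"
    and definite: "h \<in> borel_measurable M \<Longrightarrow> \<rho> h = 0 \<Longrightarrow> AE x in M. h x = 0"

locale banach_function_norm = function_norm +
  assumes cong_AE: "h \<in> borel_measurable M \<Longrightarrow> k \<in> borel_measurable M \<Longrightarrow>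
      AE x in M. h x = k x \<Longrightarrow> \<rho> h = \<rho> k"

text \<open>The \<open>L\<^sup>q\<close> norm of a function that may take the value \<open>\<infinity>\<close>; it is needed in this generality both
  for monotone limits and for local norms, which may be infinite at some centres.\<close>

definition L_norm :: "'a measure \<Rightarrow> ennreal \<Rightarrow> ('a \<Rightarrow> ennreal) \<Rightarrow> ennreal" where
  "L_norm M q h =
    (if q = \<infinity> then esssup M h
     else ennpowr (\<integral>\<^sup>+x. ennpowr (h x) (enn2real q) \<partial>M) (recip q))"

lemma L_norm_finite_exponent:
  assumes "1 \<le> s"
  shows "L_norm M (ennreal s) h = ennpowr (\<integral>\<^sup>+x. ennpowr (h x) s \<partial>M) (1 / s)"
  using assms by (simp add: L_norm_def recip_def divide_ennreal flip: ennreal_1)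

text \<open>Homogeneity, definiteness and monotone convergence pass through the power maps from the
  integral; only the triangle inequality has content.\<close>

lemma banach_function_norm_L_norm_finite:
  fixes s :: real
  assumes s: "1 \<le> s"
  shows "banach_function_norm M (L_norm M (ennreal s))"
proof -
  have s0: "0 < s"
    using s by simp
  note le_iff = L_norm_finite_exponent[OF s] ennpowr_root_le_iff[OF s0]
  show ?thesis
  proof
    fix h k :: "'a \<Rightarrow> ennreal"
    assume [measurable]: "h \<in> borel_measurable M" "k \<in> borel_measurable M"
    show "L_norm M (ennreal s) h \<le> L_norm M (ennreal s) k" if "\<And>x. h x \<le> k x"
      unfolding L_norm_finite_exponent[OF s] using s0 that
      by (intro ennpowr_mono nn_integral_mono) auto
    show "L_norm M (ennreal s) h = L_norm M (ennreal s) k" if "AE x in M. h x = k x"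
      unfolding L_norm_finite_exponent[OF s] using that
      by (intro arg_cong2[of _ _ _ _ ennpowr] nn_integral_cong_AE) auto
    show "L_norm M (ennreal s) (\<lambda>x. ennreal c * h x) = ennreal c * L_norm M (ennreal s) h" for c
      using s0 by (simp add: L_norm_finite_exponent[OF s] ennpowr_mult nn_integral_cmult
          ennpowr_ennpowr_inverse)
    show "AE x in M. h x = 0" if "L_norm M (ennreal s) h = 0"
      using that s0 by (simp add: L_norm_finite_exponent[OF s] ennpowr_eq_0_iff nn_integral_0_iff_AE)
    show "L_norm M (ennreal s) (\<lambda>x. h x + k x) \<le> L_norm M (ennreal s) h + L_norm M (ennreal s) k"
    proof (rule ennreal_le_epsilon)
      fix e :: real
      assume fin: "L_norm M (ennreal s) h + L_norm M (ennreal s) k < Orderings.top" and e: "0 < e"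
      then obtain a' b' where ab': "L_norm M (ennreal s) h = ennreal a'" "0 \<le> a'"
          "L_norm M (ennreal s) k = ennreal b'" "0 \<le> b'"
        by (cases "L_norm M (ennreal s) h"; cases "L_norm M (ennreal s) k") auto
      \<comment> \<open>The convexity estimate divides by the bounds, so they must be positive even if a norm vanishes.\<close>
      define a b where "a = a' + e / 2" and "b = b' + e / 2"
      have ab: "0 < a" "0 < b"
        using ab' e by (auto simp: a_def b_def)
      have "L_norm M (ennreal s) h \<le> ennreal a" "L_norm M (ennreal s) k \<le> ennreal b"
        using ab' e by (auto simp: a_def b_def)
      then have int: "(\<integral>\<^sup>+x. ennpowr (h x) s \<partial>M) \<le> ennreal (a powr s)"
          "(\<integral>\<^sup>+x. ennpowr (k x) s \<partial>M) \<le> ennreal (b powr s)"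
        using ab by (simp_all add: le_iff ennpowr_ennreal)
      have "(\<integral>\<^sup>+x. ennpowr (h x + k x) s \<partial>M) \<le> (\<integral>\<^sup>+x. ennreal ((a + b) powr s) *
          (ennreal (a / (a + b) / a powr s) * ennpowr (h x) s
            + ennreal (b / (a + b) / b powr s) * ennpowr (k x) s) \<partial>M)"
        by (intro nn_integral_mono ennpowr_convex s ab)
      also have "\<dots> = ennreal ((a + b) powr s) *
          (ennreal (a / (a + b) / a powr s) * (\<integral>\<^sup>+x. ennpowr (h x) s \<partial>M)
            + ennreal (b / (a + b) / b powr s) * (\<integral>\<^sup>+x. ennpowr (k x) s \<partial>M))"
        by (simp add: nn_integral_cmult nn_integral_add)
      also have "\<dots> \<le> ennreal ((a + b) powr s) *
          (ennreal (a / (a + b) / a powr s) * ennreal (a powr s)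
            + ennreal (b / (a + b) / b powr s) * ennreal (b powr s))"
        using int by (intro mult_left_mono add_mono) auto
      also have "\<dots> = ennreal ((a + b) powr s * (a / (a + b) + b / (a + b)))"
        using ab by (simp flip: ennreal_plus ennreal_mult)
      also have "\<dots> = ennpowr (ennreal (a + b)) s"
        using ab by (simp add: ennpowr_ennreal add_divide_distrib[symmetric] del: ennreal_plus)
      finally have "L_norm M (ennreal s) (\<lambda>x. h x + k x) \<le> ennreal (a + b)"
        by (simp add: le_iff)
      also have "\<dots> = L_norm M (ennreal s) h + L_norm M (ennreal s) k + ennreal e"
        using ab' e by (simp add: a_def b_def flip: ennreal_plus)
      finally show "L_norm M (ennreal s) (\<lambda>x. h x + k x)
          \<le> L_norm M (ennreal s) h + L_norm M (ennreal s) k + ennreal e" .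
    qed
  next
    fix hh :: "nat \<Rightarrow> 'a \<Rightarrow> ennreal"
    assume [measurable]: "\<And>n. hh n \<in> borel_measurable M" and inc: "incseq hh"
    have "incseq (\<lambda>n x. ennpowr (hh n x) s)"
      using inc s0 by (auto simp: incseq_def le_fun_def intro!: ennpowr_mono)
    then show "L_norm M (ennreal s) (\<lambda>x. SUP n. hh n x) \<le> (SUP n. L_norm M (ennreal s) (hh n))"
      using s0 by (simp add: L_norm_finite_exponent[OF s] ennpowr_SUP nn_integral_monotone_convergence_SUP)
  qed
qed

lemma banach_function_norm_L_norm_infinity: "banach_function_norm M (L_norm M \<infinity>)"
proof
  fix h k :: "'a \<Rightarrow> ennreal"
  assume [measurable]: "h \<in> borel_measurable M" "k \<in> borel_measurable M"
  have L: "L_norm M \<infinity> g = esssup M g" for g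
    by (simp add: L_norm_def)
  show "L_norm M \<infinity> h \<le> L_norm M \<infinity> k" if "\<And>x. h x \<le> k x"
    unfolding L using that by (intro esssup_mono) auto
  show "L_norm M \<infinity> h = L_norm M \<infinity> k" if "AE x in M. h x = k x"
    unfolding L using that by (intro antisym esssup_AE_mono) (auto elim: eventually_mono)
  show "AE x in M. h x = 0" if "L_norm M \<infinity> h = 0"
    using that esssup_AE[of h M] unfolding L by simp
  show "L_norm M \<infinity> (\<lambda>x. h x + k x) \<le> L_norm M \<infinity> h + L_norm M \<infinity> k"
    unfolding L
  proof (rule esssup_I)
    show "AE x in M. h x + k x \<le> esssup M h + esssup M k"
      using esssup_AE[of h M] esssup_AE[of k M] by eventually_elim (rule add_mono)
  qed simp
  have le: "L_norm M \<infinity> (\<lambda>x. ennreal c * g x) \<le> ennreal c * L_norm M \<infinity> g"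
    if [measurable]: "g \<in> borel_measurable M" for c and g :: "'a \<Rightarrow> ennreal"
    unfolding L
  proof (rule esssup_I)
    show "AE x in M. ennreal c * g x \<le> ennreal c * esssup M g"
      using esssup_AE[of g M] by eventually_elim (simp add: mult_left_mono)
  qed simp
  \<comment> \<open>The converse of \<open>le\<close> is \<open>le\<close> itself for the factor \<open>1 / c\<close>.\<close>
  show "L_norm M \<infinity> (\<lambda>x. ennreal c * h x) = ennreal c * L_norm M \<infinity> h" for c
  proof (cases "c \<le> 0")
    case True
    then show ?thesis
      using le[of h c] by (simp add: ennreal_neg)
  next
    case False
    then have "ennreal c * (ennreal (1 / c) * y) = y" "ennreal (1 / c) * (ennreal c * y) = y" for y
      by (simp_all flip: mult.assoc ennreal_mult)
    moreover from this have "ennreal c * L_norm M \<infinity> h \<le> L_norm M \<infinity> (\<lambda>x. ennreal c * h x)"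
      using mult_left_mono[OF le[of "\<lambda>x. ennreal c * h x" "1 / c"], of "ennreal c"] by simp
    ultimately show ?thesis
      using le[of h c] by (intro antisym) auto
  qed
next
  fix hh :: "nat \<Rightarrow> 'a \<Rightarrow> ennreal"
  assume [measurable]: "\<And>n. hh n \<in> borel_measurable M"
  have "AE x in M. \<forall>n. hh n x \<le> esssup M (hh n)"
    by (simp add: AE_all_countable esssup_AE)
  then have "AE x in M. (SUP n. hh n x) \<le> (SUP n. esssup M (hh n))"
    by eventually_elim (auto intro: SUP_mono)
  then show "L_norm M \<infinity> (\<lambda>x. SUP n. hh n x) \<le> (SUP n. L_norm M \<infinity> (hh n))"
    unfolding L_norm_def by (simp add: esssup_I)
qed

lemma banach_function_norm_L_norm:
  assumes "1 \<le> q"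
  shows "banach_function_norm M (L_norm M q)"
proof (cases q)
  case (real s)
  with assms show ?thesis
    using banach_function_norm_L_norm_finite[of s M] by (simp flip: ennreal_1)
qed (simp add: banach_function_norm_L_norm_infinity flip: infinity_ennreal_def)

lemma function_norm_SUP: "function_norm M (\<lambda>h. SUP x. h x)"
proof
  fix h k :: "'a \<Rightarrow> ennreal"
  show "(SUP x. h x) \<le> (SUP x. k x)" if "\<And>x. h x \<le> k x"
    using that by (intro SUP_mono') auto
  show "(SUP x. ennreal c * h x) = ennreal c * (SUP x. h x)" for c
    by (simp add: SUP_mult_left_ennreal)
  show "(SUP x. h x + k x) \<le> (SUP x. h x) + (SUP x. k x)"
    by (intro SUP_least add_mono SUP_upper) auto
  show "AE x in M. h x = 0" if "(SUP x. h x) = 0"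
  proof -
    have "h x \<le> 0" for x
      unfolding that[symmetric] by (rule SUP_upper) simp
    then show ?thesis by simp
  qed
next
  fix hh :: "nat \<Rightarrow> 'a \<Rightarrow> ennreal"
  show "(SUP x. SUP n. hh n x) \<le> (SUP n. SUP x. hh n x)"
    by (rule eq_refl) (rule SUP_commute)
qed

section \<open>Completeness of the space of a function norm\<close>

context banach_function_norm
begin

lemma norm_zero: "\<rho> (\<lambda>x. 0) = 0"
  using scale[of "\<lambda>x. 0" 0] by simp

lemma norm_sum_le:
  assumes [measurable]: "\<And>i::nat. h i \<in> borel_measurable M"
  shows "\<rho> (\<lambda>x. \<Sum>i<n. h i x) \<le> (\<Sum>i<n. \<rho> (h i))"
proof (induction n)
  case (Suc n)
  have "\<rho> (\<lambda>x. (\<Sum>i<n. h i x) + h n x) \<le> \<rho> (\<lambda>x. \<Sum>i<n. h i x) + \<rho> (h n)"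
    by (rule triangle) auto
  also have "\<dots> \<le> (\<Sum>i<n. \<rho> (h i)) + \<rho> (h n)"
    using Suc by (rule add_right_mono)
  finally show ?case by simp
qed (simp add: norm_zero)

lemma norm_suminf_le:
  assumes [measurable]: "\<And>i::nat. h i \<in> borel_measurable M"
  shows "\<rho> (\<lambda>x. \<Sum>i. h i x) \<le> (\<Sum>i. \<rho> (h i))"
proof -
  have "\<rho> (\<lambda>x. \<Sum>i. h i x) = \<rho> (\<lambda>x. SUP n. \<Sum>i<n. h i x)"
    by (simp add: suminf_eq_SUP)
  also have "\<dots> \<le> (SUP n. \<rho> (\<lambda>x. \<Sum>i<n. h i x))"
    by (rule monotone_convergence) (auto simp: incseq_def le_fun_def intro!: sum_mono2)
  also have "\<dots> \<le> (\<Sum>i. \<rho> (h i))"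
    unfolding suminf_eq_SUP by (intro SUP_mono') (rule norm_sum_le, simp)
  finally show ?thesis .
qed

text \<open>Fatou's lemma for \<open>\<rho>\<close>, which follows from monotone convergence just as it does for integrals.\<close>

lemma norm_liminf_le:
  assumes [measurable]: "\<And>i::nat. h i \<in> borel_measurable M" and le: "\<And>i. \<rho> (h i) \<le> C"
  shows "\<rho> (\<lambda>x. liminf (\<lambda>i. h i x)) \<le> C"
proof -
  have "\<rho> (\<lambda>x. liminf (\<lambda>i. h i x)) = \<rho> (\<lambda>x. SUP n. INF i\<in>{n..}. h i x)"
    by (simp add: liminf_SUP_INF)
  also have "\<dots> \<le> (SUP n. \<rho> (\<lambda>x. INF i\<in>{n..}. h i x))"
    by (rule monotone_convergence) (auto simp: incseq_def le_fun_def intro!: INF_superset_mono)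
  also have "\<dots> \<le> C"
  proof (rule SUP_least)
    fix n :: nat
    have "\<rho> (\<lambda>x. INF i\<in>{n..}. h i x) \<le> \<rho> (h n)"
      by (rule mono) (auto intro: INF_lower)
    then show "\<rho> (\<lambda>x. INF i\<in>{n..}. h i x) \<le> C"
      using le[of n] by simp
  qed
  finally show ?thesis .
qed

text \<open>If \<open>g\<close> is the indicator of \<open>{h = \<infinity>}\<close>, then \<open>n g \<le> h\<close> for every \<open>n\<close>, so \<open>\<rho> g \<le> \<rho> h / n\<close> and
  definiteness gives \<open>g = 0\<close> almost everywhere.\<close>

lemma AE_finite_of_norm_finite:
  assumes [measurable]: "h \<in> borel_measurable M" and fin: "\<rho> h < \<infinity>"
  shows "AE x in M. h x < \<infinity>"
proof -
  define g where "g x = (if h x = \<infinity> then 1 else 0 :: ennreal)" for x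
  have [measurable]: "g \<in> borel_measurable M"
    unfolding g_def by measurable
  have le: "ennreal (real n) * \<rho> g \<le> \<rho> h" for n
    unfolding scale[OF \<open>g \<in> borel_measurable M\<close>, symmetric]
    by (rule mono) (auto simp: g_def)
  obtain b where b: "\<rho> h = ennreal b" "0 \<le> b"
    using fin by (cases "\<rho> h") auto
  with le[of 1] obtain a where a: "\<rho> g = ennreal a" "0 \<le> a"
    by (cases "\<rho> g") (auto simp: top_unique)
  have "real n * a \<le> b" for n
    using le[of n] a b by (simp flip: ennreal_mult)
  then have "a = 0"
    using reals_Archimedean3[of a] a by (metis less_le not_le)
  then have "AE x in M. g x = 0"
    using a by (intro definite) auto
  then show ?thesis
    by eventually_elim (auto simp: g_def less_top split: if_splits)
qed

abbreviation cnorm :: "('a \<Rightarrow> complex) \<Rightarrow> ennreal" where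
  "cnorm f \<equiv> \<rho> (\<lambda>x. ennreal (cmod (f x)))"

text \<open>The Riesz--Fischer argument. Along a subsequence whose consecutive differences have norms at
  most \<open>2\<^sup>-\<^sup>k\<close>, the series of the absolute values of these differences has finite norm, hence is finite
  almost everywhere, and the subsequence converges almost everywhere. Fatou's lemma then carries
  the Cauchy estimates to the limit.\<close>

lemma Cauchy_imp_convergent:
  fixes f :: "nat \<Rightarrow> 'a \<Rightarrow> complex"
  assumes [measurable]: "\<And>n. f n \<in> borel_measurable M"
    and Cauchy: "\<And>e. 0 < e \<Longrightarrow> \<exists>N. \<forall>m\<ge>N. \<forall>n\<ge>N. cnorm (\<lambda>x. f m x - f n x) \<le> ennreal e"
  shows "\<exists>g\<in>borel_measurable M. \<forall>e>0. \<exists>N. \<forall>n\<ge>N. cnorm (\<lambda>x. f n x - g x) \<le> ennreal e"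
proof -
  have "\<exists>N. \<forall>k. \<forall>m\<ge>N k. \<forall>n\<ge>N k. cnorm (\<lambda>x. f m x - f n x) \<le> ennreal ((1 / 2) ^ k)"
    using Cauchy by (intro choice allI) simp
  then obtain N0 where N0: "\<And>k m n. N0 k \<le> m \<Longrightarrow> N0 k \<le> n \<Longrightarrow>
      cnorm (\<lambda>x. f m x - f n x) \<le> ennreal ((1 / 2) ^ k)"
    by blast
  \<comment> \<open>Partial sums make the thresholds monotone.\<close>
  define N where "N k = (\<Sum>i\<le>k. N0 i)" for k
  have "N0 k \<le> N k" for k
    unfolding N_def by (rule member_le_sum) auto
  then have N: "cnorm (\<lambda>x. f m x - f n x) \<le> ennreal ((1 / 2) ^ k)"
    if "N k \<le> m" "N k \<le> n" for k m n
    using N0 that by (meson order_trans)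
  have N_mono: "N j \<le> N k" if "j \<le> k" for j k
    unfolding N_def using that by (intro sum_mono2) auto
  define D where "D k x = ennreal (cmod (f (N (Suc k)) x - f (N k) x))" for k x
  have [measurable]: "D k \<in> borel_measurable M" for k
    unfolding D_def by measurable
  have "\<rho> (D k) \<le> ennreal ((1 / 2) ^ k)" for k
    using N[of k "N (Suc k)" "N k"] N_mono[of k "Suc k"] by (simp add: D_def[abs_def])
  then have "(\<Sum>k. \<rho> (D k)) \<le> (\<Sum>k. ennreal ((1 / 2) ^ k))"
    by (intro suminf_le) auto
  also have "\<dots> < \<infinity>"
    by (subst suminf_ennreal2) (auto simp: summable_geometric)
  finally have "\<rho> (\<lambda>x. \<Sum>k. D k x) < \<infinity>"
    using norm_suminf_le[of D] by simp
  then have "AE x in M. (\<Sum>k. D k x) < \<infinity>"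
    by (intro AE_finite_of_norm_finite) auto
  then have AE_conv: "AE x in M. convergent (\<lambda>k. f (N k) x)"
  proof eventually_elim
    case (elim x)
    then have "summable (\<lambda>k. cmod (f (N (Suc k)) x - f (N k) x))"
      by (intro summable_suminf_not_top) (auto simp: D_def less_top)
    then have "summable (\<lambda>k. f (N (Suc k)) x - f (N k) x)"
      by (rule summable_norm_cancel)
    then have "convergent (\<lambda>k. f (N k) x - f (N 0) x)"
      unfolding summable_iff_convergent using sum_lessThan_telescope[of "\<lambda>k. f (N k) x"] by simp
    then show ?case
      by (simp add: convergent_diff_const_right_iff)
  qed
  define g where "g x = lim (\<lambda>k. f (N k) x)" for x
  have g[measurable]: "g \<in> borel_measurable M"
    unfolding g_def by measurable
  show ?thesis
  proof (intro bexI[OF _ g] allI impI)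
    fix e :: real
    assume "0 < e"
    then obtain k where k: "(1 / 2) ^ k < e"
      using real_arch_pow_inv[of e "1 / 2"] by auto
    have "cnorm (\<lambda>x. f n x - g x) \<le> ennreal e" if n: "N k \<le> n" for n
    proof -
      have "AE x in M. liminf (\<lambda>j. ennreal (cmod (f n x - f (N (j + k)) x))) = ennreal (cmod (f n x - g x))"
        using AE_conv
      proof eventually_elim
        case (elim x)
        then have "(\<lambda>j. f (N (j + k)) x) \<longlonglongrightarrow> g x"
          unfolding g_def convergent_LIMSEQ_iff by (rule LIMSEQ_ignore_initial_segment)
        then have "(\<lambda>j. ennreal (cmod (f n x - f (N (j + k)) x))) \<longlonglongrightarrow> ennreal (cmod (f n x - g x))"
          by (intro tendsto_ennrealI tendsto_intros)
        then show ?case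
          by (intro lim_imp_Liminf) auto
      qed
      then have "cnorm (\<lambda>x. f n x - g x) = \<rho> (\<lambda>x. liminf (\<lambda>j. ennreal (cmod (f n x - f (N (j + k)) x))))"
        by (intro cong_AE) (auto elim: eventually_mono)
      also have "\<dots> \<le> ennreal ((1 / 2) ^ k)"
        using n by (intro norm_liminf_le N N_mono) auto
      finally show ?thesis
        using k by (meson ennreal_leI less_imp_le order_trans)
    qed
    then show "\<exists>N. \<forall>n\<ge>N. cnorm (\<lambda>x. f n x - g x) \<le> ennreal e"
      by blast
  qed
qed

lemma cnorm_cong:
  "f \<in> borel_measurable M \<Longrightarrow> g \<in> borel_measurable M \<Longrightarrow> AE x in M. f x = g x \<Longrightarrow> cnorm f = cnorm g"
  by (rule cong_AE) (auto elim: eventually_mono)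

lemma cnorm_add_le:
  assumes [measurable]: "f \<in> borel_measurable M" "g \<in> borel_measurable M"
  shows "cnorm (\<lambda>x. f x + g x) \<le> cnorm f + cnorm g"
proof -
  have "cnorm (\<lambda>x. f x + g x) \<le> \<rho> (\<lambda>x. ennreal (cmod (f x)) + ennreal (cmod (g x)))"
    by (rule mono) (auto simp: norm_triangle_ineq simp flip: ennreal_plus)
  also have "\<dots> \<le> cnorm f + cnorm g"
    by (rule triangle) auto
  finally show ?thesis .
qed

lemma cnorm_cmult:
  assumes [measurable]: "f \<in> borel_measurable M"
  shows "cnorm (\<lambda>x. c * f x) = ennreal (cmod c) * cnorm f"
  using scale[of "\<lambda>x. ennreal (cmod (f x))" "cmod c"] by (simp add: norm_mult ennreal_mult)

lemma cnorm_eq_0_iff: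
  assumes [measurable]: "f \<in> borel_measurable M"
  shows "cnorm f = 0 \<longleftrightarrow> (AE x in M. f x = 0)"
proof
  assume "cnorm f = 0"
  then have "AE x in M. ennreal (cmod (f x)) = 0"
    by (intro definite) auto
  then show "AE x in M. f x = 0"
    by eventually_elim simp
next
  assume "AE x in M. f x = 0"
  then show "cnorm f = 0"
    using cnorm_cong[of f "\<lambda>x. 0"] norm_zero by simp
qed

end

section \<open>Classes of functions\<close>

abbreviation ae_class :: "'a measure \<Rightarrow> ('a \<Rightarrow> complex) \<Rightarrow> ('a \<Rightarrow> complex) set" where
  "ae_class M f \<equiv> ae_rel M `` {f}"

lemma equiv_ae_rel: "equiv (borel_measurable M) (ae_rel M)"
proof (rule equivI)
  show "ae_rel M \<subseteq> borel_measurable M \<times> borel_measurable M"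
    by (auto simp: ae_rel_def)
  show "refl_on (borel_measurable M) (ae_rel M)"
    by (auto simp: refl_on_def ae_rel_def)
  show "sym (ae_rel M)"
    by (auto simp: sym_def ae_rel_def elim: eventually_mono)
  show "trans (ae_rel M)"
    by (auto simp: trans_def ae_rel_def elim: eventually_elim2)
qed

lemma ae_class_eq_iff:
  assumes "f \<in> borel_measurable M" "g \<in> borel_measurable M"
  shows "ae_class M f = ae_class M g \<longleftrightarrow> (AE x in M. f x = g x)"
  using eq_equiv_class_iff[OF equiv_ae_rel assms] assms by (simp add: ae_rel_def)

lemma carrier_L0E:
  assumes "F \<in> carrier (L0 M)"
  obtains f where "f \<in> borel_measurable M" "F = ae_class M f"
  using assms by (auto simp: L0_def elim: quotientE)

lemma ae_class_in_L0: "f \<in> borel_measurable M \<Longrightarrow> ae_class M f \<in> carrier (L0 M)"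
  by (simp add: L0_def quotientI)

text \<open>The operations of \<^const>\<open>L0\<close> are unions over all representatives; this evaluates such a union
  at a single one.\<close>

lemma UN_ae_class:
  assumes f: "f \<in> borel_measurable M" and "\<And>g. (f, g) \<in> ae_rel M \<Longrightarrow> \<Phi> g = \<Phi> f"
  shows "(\<Union>g\<in>ae_class M f. \<Phi> g) = \<Phi> f"
proof -
  have "(f, f) \<in> ae_rel M"
    using f by (simp add: ae_rel_def)
  then show ?thesis
    using assms(2) by blast
qed

lemma L0_smult:
  assumes [measurable]: "f \<in> borel_measurable M"
  shows "smult (L0 M) c (ae_class M f) = ae_class M (\<lambda>x. c * f x)"
proof -
  have "(\<Union>g\<in>ae_class M f. ae_class M (\<lambda>x. c * g x)) = ae_class M (\<lambda>x. c * f x)"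
  proof (rule UN_ae_class[OF assms])
    fix g assume "(f, g) \<in> ae_rel M"
    then have [measurable]: "g \<in> borel_measurable M" and "AE x in M. f x = g x"
      by (auto simp: ae_rel_def)
    from this(2) have "AE x in M. c * g x = c * f x"
      by eventually_elim simp
    then show "ae_class M (\<lambda>x. c * g x) = ae_class M (\<lambda>x. c * f x)"
      by (simp add: ae_class_eq_iff)
  qed
  then show ?thesis
    by (simp add: L0_def)
qed

lemma L0_add:
  assumes [measurable]: "f \<in> borel_measurable M" "g \<in> borel_measurable M"
  shows "add (L0 M) (ae_class M f) (ae_class M g) = ae_class M (\<lambda>x. f x + g x)"
proof -
  have inner: "(\<Union>g'\<in>ae_class M g. ae_class M (\<lambda>x. f' x + g' x)) = ae_class M (\<lambda>x. f' x + g x)"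
    if "f' \<in> borel_measurable M" for f'
    using that
    by (intro UN_ae_class, simp, subst ae_class_eq_iff) (auto simp: ae_rel_def elim: eventually_mono)
  have "(\<Union>f'\<in>ae_class M f. \<Union>g'\<in>ae_class M g. ae_class M (\<lambda>x. f' x + g' x)) =
      (\<Union>f'\<in>ae_class M f. ae_class M (\<lambda>x. f' x + g x))"
    by (intro SUP_cong refl inner) (auto simp: ae_rel_def)
  also have "\<dots> = ae_class M (\<lambda>x. f x + g x)"
    by (rule UN_ae_class, simp, subst ae_class_eq_iff) (auto simp: ae_rel_def elim: eventually_mono)
  finally show ?thesis
    by (simp add: L0_def)
qed

lemma L0_zero: "ring.zero (L0 M) = ae_class M (\<lambda>x. 0)"
  by (simp add: L0_def)

context banach_function_norm
begin

definition class_norm :: "('a \<Rightarrow> complex) set \<Rightarrow> ennreal" where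
  "class_norm F = the_elem (cnorm ` F)"

definition function_space :: "(complex, ('a \<Rightarrow> complex) set) module" where
  "function_space = (L0 M)\<lparr>carrier := {F \<in> carrier (L0 M). class_norm F < \<infinity>}\<rparr>"

lemma class_norm_ae_class:
  assumes "f \<in> borel_measurable M"
  shows "class_norm (ae_class M f) = cnorm f"
proof -
  have "cnorm ` ae_class M f = {cnorm f}"
    using assms by (auto simp: ae_rel_def intro!: cnorm_cong image_eqI[of _ _ f] elim: eventually_mono)
  then show ?thesis
    by (simp add: class_norm_def)
qed

lemma function_spaceE:
  assumes "F \<in> carrier function_space"
  obtains f where "f \<in> borel_measurable M" "cnorm f < \<infinity>" "F = ae_class M f"
  using assms by (auto simp: function_space_def class_norm_ae_class elim!: carrier_L0E)

lemma ae_class_in_function_space: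
  "f \<in> borel_measurable M \<Longrightarrow> ae_class M f \<in> carrier function_space \<longleftrightarrow> cnorm f < \<infinity>"
  by (simp add: function_space_def ae_class_in_L0 class_norm_ae_class)

lemma function_space_ops:
  "f \<in> borel_measurable M \<Longrightarrow> smult function_space c (ae_class M f) = ae_class M (\<lambda>x. c * f x)"
  "f \<in> borel_measurable M \<Longrightarrow> g \<in> borel_measurable M \<Longrightarrow>
    add function_space (ae_class M f) (ae_class M g) = ae_class M (\<lambda>x. f x + g x)"
  "ring.zero function_space = ae_class M (\<lambda>x. 0)"
  by (simp_all add: function_space_def L0_smult L0_add L0_zero)

lemma cnorm_add_finite:
  "f \<in> borel_measurable M \<Longrightarrow> g \<in> borel_measurable M \<Longrightarrow> cnorm f < \<infinity> \<Longrightarrow> cnorm g < \<infinity> \<Longrightarrow>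
    cnorm (\<lambda>x. f x + g x) < \<infinity>"
  using cnorm_add_le[of f g] by (auto simp: ennreal_add_less_top elim: le_less_trans)

lemma cnorm_cmult_finite:
  "f \<in> borel_measurable M \<Longrightarrow> cnorm f < \<infinity> \<Longrightarrow> cnorm (\<lambda>x. c * f x) < \<infinity>"
  by (simp add: cnorm_cmult ennreal_mult_less_top)

lemma abelian_group_function_space: "abelian_group function_space"
proof (rule abelian_groupI; (elim function_spaceE)?)
  show "ring.zero function_space \<in> carrier function_space"
    by (simp add: function_space_ops ae_class_in_function_space norm_zero)
  show "\<exists>G\<in>carrier function_space. add function_space G F = ring.zero function_space"
    if [measurable]: "f \<in> borel_measurable M" and "cnorm f < \<infinity>" "F = ae_class M f" for F f
    using that cnorm_cmult_finite[of f "- 1"]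
    by (intro bexI[of _ "ae_class M (\<lambda>x. - 1 * f x)"])
      (simp_all add: function_space_ops ae_class_in_function_space)
qed (auto simp: function_space_ops ae_class_in_function_space cnorm_add_finite[simplified] add_ac)

text \<open>The axioms hold pointwise for representatives, and the triangle inequality and homogeneity of
  the norm keep sums and multiples inside the carrier.\<close>

lemma module_function_space: "Module.module (ring_of_type_algebra :: complex ring) function_space"
proof (rule moduleI[OF cring_from_type_algebra abelian_group_function_space]; (elim function_spaceE)?)
qed (auto simp: function_space_ops ae_class_in_function_space cnorm_cmult_finite[simplified]
    ring_of_type_algebra_def algebra_simps)

lemma function_space_minus:
  assumes [measurable]: "f \<in> borel_measurable M" "g \<in> borel_measurable M"
    and "cnorm f < \<infinity>" "cnorm g < \<infinity>"
  shows "a_minus function_space (ae_class M f) (ae_class M g) = ae_class M (\<lambda>x. f x - g x)"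
proof -
  interpret abelian_group function_space
    by (rule abelian_group_function_space)
  have "a_inv function_space (ae_class M g) = ae_class M (\<lambda>x. - 1 * g x)"
    using assms cnorm_cmult_finite[of g "- 1"]
    by (intro minus_equality) (simp_all add: function_space_ops ae_class_in_function_space)
  then show ?thesis
    by (simp add: minus_eq function_space_ops)
qed

theorem complex_banach_space_function_space:
  "complex_banach_space function_space (\<lambda>F. enn2real (class_norm F))"
proof -
  have fin: "ennreal (enn2real (cnorm f)) = cnorm f" if "cnorm f < \<infinity>" for f
    using that by (intro ennreal_enn2real) (simp add: less_top)
  interpret complex_normed_space function_space "\<lambda>F. enn2real (class_norm F)"
  proof (intro complex_normed_space.intro complex_normed_space_axioms.intro module_function_space;
      (elim function_spaceE)?)
    show "enn2real (class_norm F) = 0 \<longleftrightarrow> F = ring.zero function_space"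
      if "f \<in> borel_measurable M" "cnorm f < \<infinity>" "F = ae_class M f" for F f
      using that
      by (auto simp: class_norm_ae_class function_space_ops ae_class_eq_iff cnorm_eq_0_iff
          enn2real_eq_0_iff)
    show "enn2real (class_norm (add function_space F G)) \<le> enn2real (class_norm F) + enn2real (class_norm G)"
      if "f \<in> borel_measurable M" "cnorm f < \<infinity>" "F = ae_class M f"
        "g \<in> borel_measurable M" "cnorm g < \<infinity>" "G = ae_class M g" for F G f g
      using that cnorm_add_le[of f g] enn2real_mono[of "cnorm (\<lambda>x. f x + g x)" "cnorm f + cnorm g"]
      by (simp add: class_norm_ae_class function_space_ops enn2real_plus)
  qed (simp_all add: class_norm_ae_class function_space_ops cnorm_cmult enn2real_mult)
  interpret Metric_space "carrier function_space" "nrm_dist function_space (\<lambda>F. enn2real (class_norm F))"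
    by (rule Metric_space_nrm_dist)
  have dist: "nrm_dist function_space (\<lambda>F. enn2real (class_norm F)) (ae_class M f) (ae_class M g) =
      enn2real (cnorm (\<lambda>x. f x - g x))"
    if "f \<in> borel_measurable M" "cnorm f < \<infinity>" "g \<in> borel_measurable M" "cnorm g < \<infinity>" for f g
    using that
    by (simp add: nrm_dist_def ae_class_in_function_space function_space_minus class_norm_ae_class)
  have diff_fin: "cnorm (\<lambda>x. f x - g x) < \<infinity>"
    if "f \<in> borel_measurable M" "cnorm f < \<infinity>" "g \<in> borel_measurable M" "cnorm g < \<infinity>" for f g
    using that cnorm_add_finite[of f "\<lambda>x. - 1 * g x"] cnorm_cmult_finite[of g "- 1"] by simp
  have "mcomplete"
    unfolding mcomplete_def
  proof (intro allI impI)
    fix \<sigma> assume \<sigma>: "MCauchy \<sigma>"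
    then have "\<sigma> n \<in> carrier function_space" for n
      by (auto simp: MCauchy_def)
    then have "\<exists>f. f \<in> borel_measurable M \<and> cnorm f < \<infinity> \<and> \<sigma> n = ae_class M f" for n
      by (rule function_spaceE) blast
    then have "\<exists>f. \<forall>n. f n \<in> borel_measurable M \<and> cnorm (f n) < \<infinity> \<and> \<sigma> n = ae_class M (f n)"
      by (intro choice allI)
    then obtain f where f[measurable]: "\<And>n. f n \<in> borel_measurable M"
      and f_fin: "\<And>n. cnorm (f n) < \<infinity>" and \<sigma>_eq: "\<And>n. \<sigma> n = ae_class M (f n)"
      by blast
    have "\<exists>N. \<forall>m\<ge>N. \<forall>n\<ge>N. cnorm (\<lambda>x. f m x - f n x) \<le> ennreal e" if e: "0 < e" for e
    proof -
      obtain N where N: "\<forall>m n. N \<le> m \<longrightarrow> N \<le> n \<longrightarrow>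
          nrm_dist function_space (\<lambda>F. enn2real (class_norm F)) (\<sigma> m) (\<sigma> n) < e"
        using \<sigma> e unfolding MCauchy_def by blast
      have "cnorm (\<lambda>x. f m x - f n x) \<le> ennreal e" if "N \<le> m" "N \<le> n" for m n
      proof -
        have "enn2real (cnorm (\<lambda>x. f m x - f n x)) \<le> e"
          using N that by (simp add: \<sigma>_eq dist[OF f f_fin f f_fin] less_imp_le)
        then show ?thesis
          using ennreal_leI fin[OF diff_fin[OF f f_fin f f_fin], of m n] by fastforce
      qed
      then show ?thesis
        by blast
    qed
    then have "\<exists>g\<in>borel_measurable M. \<forall>e>0. \<exists>N. \<forall>n\<ge>N. cnorm (\<lambda>x. f n x - g x) \<le> ennreal e"
      by (rule Cauchy_imp_convergent[OF f])
    then obtain g where g[measurable]: "g \<in> borel_measurable M"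
      and lim: "\<And>e. 0 < e \<Longrightarrow> \<exists>N. \<forall>n\<ge>N. cnorm (\<lambda>x. f n x - g x) \<le> ennreal e"
      by blast
    obtain n where n: "cnorm (\<lambda>x. f n x - g x) \<le> ennreal 1"
      using lim[of 1] by auto
    have "cnorm (\<lambda>x. - 1 * (f n x - g x)) < \<infinity>"
      using n by (intro cnorm_cmult_finite) (auto elim: le_less_trans)
    then have g_fin: "cnorm g < \<infinity>"
      using cnorm_add_finite[of "f n" "\<lambda>x. - 1 * (f n x - g x)"] f_fin[of n] by simp
    have "limitin mtopology \<sigma> (ae_class M g) sequentially"
      unfolding limitin_metric
    proof (intro conjI allI impI)
      show "ae_class M g \<in> carrier function_space"
        using g_fin by (simp add: ae_class_in_function_space)
      fix e :: real
      assume e: "0 < e"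
      then obtain N where N: "\<And>n. N \<le> n \<Longrightarrow> cnorm (\<lambda>x. f n x - g x) \<le> ennreal (e / 2)"
        using lim[of "e / 2"] by auto
      have "enn2real (cnorm (\<lambda>x. f n x - g x)) < e" if "N \<le> n" for n
      proof -
        have "enn2real (cnorm (\<lambda>x. f n x - g x)) \<le> e / 2"
          using N[OF that] e by (intro enn2real_leI) auto
        then show ?thesis
          using e by simp
      qed
      then show "\<forall>\<^sub>F n in sequentially. \<sigma> n \<in> carrier function_space \<and>
          nrm_dist function_space (\<lambda>F. enn2real (class_norm F)) (\<sigma> n) (ae_class M g) < e"
        using f_fin
        by (auto simp: \<sigma>_eq dist[OF f f_fin g g_fin] ae_class_in_function_space eventually_sequentially)
    qed
    then show "\<exists>F. limitin mtopology \<sigma> F sequentially" ..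
  qed
  then show ?thesis
    by unfold_locales
qed

end

section \<open>Averaging over balls\<close>

context homogeneous_space
begin

lemma sets_qball [measurable]: "qball d y r \<in> sets \<mu>"
  by (intro borel balls_open)

lemma emeasure_qball_pos:
  assumes "0 < s"
  shows "0 < emeasure \<mu> (qball d x s)"
proof -
  obtain C where "0 < emeasure \<mu> (qball d x (2 * (s / 2)))"
    using doubling assms half_gt_zero by blast
  then show ?thesis
    by simp
qed

lemma emeasure_qball_finite:
  assumes "0 < s"
  shows "emeasure \<mu> (qball d x s) < \<infinity>"
proof -
  obtain C where C: "0 < emeasure \<mu> (qball d x (2 * s))"
      "emeasure \<mu> (qball d x (2 * s)) \<le> ennreal C * emeasure \<mu> (qball d x s)"
      "ennreal C * emeasure \<mu> (qball d x s) < \<infinity>"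
    using doubling assms by blast
  then have "ennreal C \<noteq> 0"
    by auto
  with C(3) show ?thesis
    by (auto simp: ennreal_mult_less_top)
qed

text \<open>Balls of a fixed radius do not shrink abruptly in the limit: if \<open>z\<^sub>n\<close> tends to \<open>y\<close> and \<open>x\<close> lies in
  \<open>B(y, r)\<close>, then \<open>y\<close> lies in the open set \<open>B(x, r)\<close>, so \<open>z\<^sub>n\<close> eventually does and \<open>x\<close> lies in
  \<open>B(z\<^sub>n, r)\<close>. Fatou's lemma then makes \<open>y \<mapsto> \<integral>\<^bsub>B(y, r)\<^esub> g d\<mu>\<close> lower semicontinuous. This gives
  measurability in the centre without any product measure.\<close>

lemma openin_integral_over_ball_greater:
  assumes [measurable]: "g \<in> borel_measurable \<mu>"
  shows "openin (d_topology d) {y. t < (\<integral>\<^sup>+x. g x * indicator (qball d y r) x \<partial>\<mu>)}"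
proof (rule ccontr)
  let ?I = "\<lambda>y. \<integral>\<^sup>+x. g x * indicator (qball d y r) x \<partial>\<mu>"
  assume "\<not> openin (d_topology d) {y. t < ?I y}"
  then obtain y where y: "t < ?I y" and near: "\<And>s. 0 < s \<Longrightarrow> \<exists>z\<in>qball d y s. ?I z \<le> t"
    by (force simp: openin_d_topology not_less)
  have "\<exists>z. \<forall>n. z n \<in> qball d y (1 / real (Suc n)) \<and> ?I (z n) \<le> t"
    using near by (intro choice allI) (simp add: Bex_def)
  then obtain z where z: "\<And>n. z n \<in> qball d y (1 / real (Suc n))" "\<And>n. ?I (z n) \<le> t"
    by blast
  have "g x * indicator (qball d y r) x \<le> liminf (\<lambda>n. g x * indicator (qball d (z n) r) x)" for x
  proof (cases "x \<in> qball d y r")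
    case True
    then have "y \<in> qball d x r"
      by (simp add: qball_def sym)
    then obtain s where s: "0 < s" "qball d y s \<subseteq> qball d x r"
      using balls_open by (meson openin_d_topology)
    have "\<forall>\<^sub>F n in sequentially. 1 / real (Suc n) < s"
      using order_tendstoD(2)[OF LIMSEQ_inverse_real_of_nat s(1)] by (simp add: inverse_eq_divide)
    then have "\<forall>\<^sub>F n in sequentially. x \<in> qball d (z n) r"
    proof eventually_elim
      case (elim n)
      then have "z n \<in> qball d x r"
        using z(1)[of n] s(2) by (force simp: qball_def)
      then show ?case
        by (simp add: qball_def sym)
    qed
    then have "\<forall>\<^sub>F n in sequentially.
        g x * indicator (qball d y r) x \<le> g x * indicator (qball d (z n) r) x"
      by eventually_elim (simp add: True)
    then show ?thesis
      by (rule Liminf_bounded)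
  qed simp
  then have "?I y \<le> (\<integral>\<^sup>+x. liminf (\<lambda>n. g x * indicator (qball d (z n) r) x) \<partial>\<mu>)"
    by (intro nn_integral_mono)
  also have "\<dots> \<le> liminf (\<lambda>n. ?I (z n))"
    by (rule nn_integral_liminf) measurable
  also have "\<dots> \<le> t"
    using z(2) Liminf_mono[of "\<lambda>n. ?I (z n)" "\<lambda>n. t" sequentially] by (simp add: Liminf_const)
  finally show False
    using y by simp
qed

lemma measurable_integral_over_ball:
  assumes "g \<in> borel_measurable \<mu>"
  shows "(\<lambda>y. \<integral>\<^sup>+x. g x * indicator (qball d y r) x \<partial>\<mu>) \<in> borel_measurable \<mu>"
  by (rule borel_measurableI_greater)
    (simp add: space_UNIV borel openin_integral_over_ball_greater assms)

lemma measurable_measure_qball [measurable]: "(\<lambda>y. measure \<mu> (qball d y r)) \<in> borel_measurable \<mu>"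
  using borel_measurable_enn2real[OF measurable_integral_over_ball[of "\<lambda>x. 1" r]]
  by (simp add: measure_def)

lemma measurable_L_norm_over_ball:
  assumes q: "1 \<le> q" and h[measurable]: "h \<in> borel_measurable \<mu>"
  shows "(\<lambda>y. L_norm \<mu> q (\<lambda>x. h x * indicator (qball d y r) x)) \<in> borel_measurable \<mu>"
proof (cases q)
  case (real s)
  with q have s: "1 \<le> s"
    by (simp flip: ennreal_1)
  have "ennpowr (h x * indicator B x) s = ennpowr (h x) s * indicator B x" for x B
    by (simp split: split_indicator)
  then show ?thesis
    unfolding real L_norm_finite_exponent[OF s]
    by (simp add: measurable_ennpowr measurable_integral_over_ball)
next
  case top
  \<comment> \<open>The essential supremum over a ball exceeds \<open>t\<close> iff the ball meets \<open>{h > t}\<close> in positive measure.\<close>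
  show ?thesis
  proof (rule borel_measurableI_greater)
    fix t :: ennreal
    let ?A = "{x. t < h x}"
    have [measurable]: "?A \<in> sets \<mu>"
      using borel_measurable_less[of "\<lambda>_. t" \<mu> h] by (simp add: space_UNIV)
    have "t < L_norm \<mu> q (\<lambda>x. h x * indicator (qball d y r) x) \<longleftrightarrow>
        0 < (\<integral>\<^sup>+x. indicator ?A x * indicator (qball d y r) x \<partial>\<mu>)" for y
    proof -
      let ?f = "\<lambda>x. h x * indicator (qball d y r) x"
      have "esssup \<mu> ?f \<le> t \<longleftrightarrow> (AE x in \<mu>. ?f x \<le> t)"
        using esssup_AE[of ?f \<mu>] by (auto intro: esssup_I elim: eventually_mono)
      also have "\<dots> \<longleftrightarrow> (AE x in \<mu>. indicator ?A x * indicator (qball d y r) x = (0 :: ennreal))"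
        by (intro arg_cong[where f = "\<lambda>P. eventually P (ae_filter \<mu>)"] ext)
          (auto split: split_indicator)
      also have "\<dots> \<longleftrightarrow> (\<integral>\<^sup>+x. indicator ?A x * indicator (qball d y r) x \<partial>\<mu>) = 0"
        by (rule nn_integral_0_iff_AE[symmetric]) measurable
      finally show ?thesis
        unfolding top L_norm_def by (simp add: zero_less_iff_neq_zero flip: not_le)
    qed
    then show "{y \<in> space \<mu>. t < L_norm \<mu> q (\<lambda>x. h x * indicator (qball d y r) x)} \<in> sets \<mu>"
      by (simp add: space_UNIV borel openin_integral_over_ball_greater)
  qed
qed

text \<open>Every ball has positive measure, so it contains a point where \<open>P\<close> holds. Choosing such points
  within distance \<open>r / (2\<kappa>)\<close> of the points of a countable dense set gives centres whose balls of
  radius \<open>r\<close> reach every point, by the quasi-triangle inequality.\<close>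

lemma countable_ball_cover:
  assumes r: "0 < r" and P: "AE y in \<mu>. P y"
  obtains Y where "countable Y" "\<And>y. y \<in> Y \<Longrightarrow> P y" "\<And>x. \<exists>y\<in>Y. x \<in> qball d y r"
proof -
  obtain \<kappa> where \<kappa>: "1 \<le> \<kappa>" "\<And>x y z. d x y \<le> \<kappa> * (d x z + d z y)"
    using quasi_triangle by blast
  define s where "s = r / (2 * \<kappa>)"
  have s: "0 < s" "\<kappa> * (s + s) = r"
    using r \<kappa>(1) by (auto simp: s_def field_simps)
  have top: "topspace (d_topology d) = UNIV"
    by (auto simp: topspace_def openin_d_topology intro!: exI[of _ UNIV] gt_ex)
  obtain C where C: "countable C" "d_topology d closure_of C = UNIV"
    using separable by (auto simp: separable_space_def top)
  have "\<exists>y\<in>qball d x s. P y" for x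
  proof (rule ccontr)
    assume "\<not> (\<exists>y\<in>qball d x s. P y)"
    with P have "AE y in \<mu>. y \<notin> qball d x s"
      by (auto elim: eventually_mono)
    then have "qball d x s \<in> null_sets \<mu>"
      by (simp add: AE_iff_null_sets)
    then show False
      using emeasure_qball_pos[OF s(1), of x] by auto
  qed
  then obtain \<eta> where \<eta>: "\<And>x. \<eta> x \<in> qball d x s" "\<And>x. P (\<eta> x)"
    by metis
  show ?thesis
  proof (rule that[of "\<eta> ` C"])
    fix z
    have "z \<in> d_topology d closure_of C"
      using C by simp
    moreover have "z \<in> qball d z s"
      using s eq_0_iff[of z z] by (simp add: qball_def)
    ultimately obtain x where x: "x \<in> C" "x \<in> qball d z s"
      using balls_open by (auto simp: in_closure_of)
    have "d z (\<eta> x) \<le> \<kappa> * (d z x + d x (\<eta> x))"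
      by (rule \<kappa>(2))
    also have "\<dots> < \<kappa> * (s + s)"
      using x(2) \<eta>(1)[of x] \<kappa>(1) by (intro mult_strict_left_mono) (auto simp: qball_def)
    finally have "z \<in> qball d (\<eta> x) r"
      unfolding s(2) by (simp add: qball_def sym)
    with x(1) show "\<exists>y\<in>\<eta> ` C. z \<in> qball d y r"
      by blast
  qed (use C \<eta> in auto)
qed

text \<open>All axioms but definiteness and almost-everywhere invariance are inherited from the two norms,
  once the local norms are known to be measurable in the centre. Invariance needs only that of the
  inner norm, so the outer one may be the supremum over all centres. For definiteness, vanishing
  of the local norms at almost every centre suffices by the countable cover.\<close>

lemma banach_function_norm_averages_over_balls:
  assumes q: "1 \<le> q" and r: "0 < r" and \<Phi>: "function_norm \<mu> \<Phi>"
    and w[measurable]: "w \<in> borel_measurable \<mu>" and w_pos: "\<And>y. 0 < w y"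
  shows "banach_function_norm \<mu>
    (\<lambda>h. \<Phi> (\<lambda>y. w y * L_norm \<mu> q (\<lambda>x. h x * indicator (qball d y r) x)))"
proof -
  interpret \<Phi>: function_norm \<mu> \<Phi>
    by (rule \<Phi>)
  interpret L: banach_function_norm \<mu> "L_norm \<mu> q"
    by (rule banach_function_norm_L_norm[OF q])
  let ?L = "\<lambda>h y. L_norm \<mu> q (\<lambda>x. h x * indicator (qball d y r) x)"
  have meas[measurable]: "(\<lambda>y. w y * ?L h y) \<in> borel_measurable \<mu>" if "h \<in> borel_measurable \<mu>" for h
    using measurable_L_norm_over_ball[OF q that] by measurable
  have le: "w y * ?L h y \<le> w y * ?L k y"
    if [measurable]: "h \<in> borel_measurable \<mu>" "k \<in> borel_measurable \<mu>" and "\<And>x. h x \<le> k x" for h k y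
    using that by (intro mult_left_mono L.mono mult_right_mono) auto
  show ?thesis
  proof
    fix h k :: "'a \<Rightarrow> ennreal"
    assume h[measurable]: "h \<in> borel_measurable \<mu>" and k[measurable]: "k \<in> borel_measurable \<mu>"
    show "\<Phi> (\<lambda>y. w y * ?L h y) \<le> \<Phi> (\<lambda>y. w y * ?L k y)" if "\<And>x. h x \<le> k x"
      by (intro \<Phi>.mono meas le h k that)
    show "\<Phi> (\<lambda>y. w y * ?L h y) = \<Phi> (\<lambda>y. w y * ?L k y)" if "AE x in \<mu>. h x = k x"
    proof -
      have "?L h y = ?L k y" for y
        using that by (intro L.cong_AE) (auto elim: eventually_mono)
      then show ?thesis
        by simp
    qed
    show "\<Phi> (\<lambda>y. w y * ?L (\<lambda>x. ennreal c * h x) y) = ennreal c * \<Phi> (\<lambda>y. w y * ?L h y)" for c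
    proof -
      have "?L (\<lambda>x. ennreal c * h x) y = ennreal c * ?L h y" for y
        using L.scale[of "\<lambda>x. h x * indicator (qball d y r) x" c] by (simp add: mult.assoc)
      then show ?thesis
        using \<Phi>.scale[OF meas[OF h], of c] by (simp add: mult.left_commute)
    qed
    show "\<Phi> (\<lambda>y. w y * ?L (\<lambda>x. h x + k x) y) \<le> \<Phi> (\<lambda>y. w y * ?L h y) + \<Phi> (\<lambda>y. w y * ?L k y)"
    proof -
      have "?L (\<lambda>x. h x + k x) y \<le> ?L h y + ?L k y" for y
        unfolding distrib_right by (rule L.triangle) measurable
      then have "w y * ?L (\<lambda>x. h x + k x) y \<le> w y * ?L h y + w y * ?L k y" for y
        unfolding distrib_left[symmetric] by (intro mult_left_mono) auto
      then have "\<Phi> (\<lambda>y. w y * ?L (\<lambda>x. h x + k x) y) \<le> \<Phi> (\<lambda>y. w y * ?L h y + w y * ?L k y)"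
        using meas[OF h] meas[OF k] by (intro \<Phi>.mono meas) auto
      also have "\<dots> \<le> \<Phi> (\<lambda>y. w y * ?L h y) + \<Phi> (\<lambda>y. w y * ?L k y)"
        by (intro \<Phi>.triangle meas h k)
      finally show ?thesis .
    qed
    show "AE x in \<mu>. h x = 0" if "\<Phi> (\<lambda>y. w y * ?L h y) = 0"
    proof -
      have "w y \<noteq> 0" for y
        using w_pos[of y] by simp
      then have "AE y in \<mu>. ?L h y = 0"
        using \<Phi>.definite[OF meas[OF h] that] by simp
      then obtain Y where Y: "countable Y" "\<And>y. y \<in> Y \<Longrightarrow> ?L h y = 0" "\<And>x. \<exists>y\<in>Y. x \<in> qball d y r"
        using countable_ball_cover[OF r] by blast
      have "AE x in \<mu>. h x * indicator (qball d y r) x = 0" if "y \<in> Y" for y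
        using Y(2)[OF that] by (intro L.definite) auto
      then have "AE x in \<mu>. \<forall>y\<in>Y. h x * indicator (qball d y r) x = 0"
        unfolding AE_ball_countable[OF Y(1)] by blast
      then show ?thesis
      proof eventually_elim
        case (elim x)
        then show ?case
          using Y(3)[of x] by auto
      qed
    qed
  next
    fix hh :: "nat \<Rightarrow> 'a \<Rightarrow> ennreal"
    assume hh[measurable]: "\<And>n. hh n \<in> borel_measurable \<mu>" and inc: "incseq hh"
    have "w y * ?L (\<lambda>x. SUP n. hh n x) y \<le> (SUP n. w y * ?L (hh n) y)" for y
    proof -
      have "?L (\<lambda>x. SUP n. hh n x) y = L_norm \<mu> q (\<lambda>x. SUP n. hh n x * indicator (qball d y r) x)"
        by (simp add: SUP_mult_right_ennreal)
      also have "\<dots> \<le> (SUP n. ?L (hh n) y)"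
        using inc by (intro L.monotone_convergence) (auto simp: incseq_def le_fun_def mult_right_mono)
      finally show ?thesis
        unfolding SUP_mult_left_ennreal[symmetric] by (intro mult_left_mono) auto
    qed
    then have "\<Phi> (\<lambda>y. w y * ?L (\<lambda>x. SUP n. hh n x) y) \<le> \<Phi> (\<lambda>y. SUP n. w y * ?L (hh n) y)"
      by (intro \<Phi>.mono meas borel_measurable_SUP hh) auto
    also have "\<dots> \<le> (SUP n. \<Phi> (\<lambda>y. w y * ?L (hh n) y))"
      using inc by (intro \<Phi>.monotone_convergence meas hh)
        (auto simp: incseq_def le_fun_def intro!: le)
    finally show "\<Phi> (\<lambda>y. w y * ?L (\<lambda>x. SUP n. hh n x) y) \<le> (SUP n. \<Phi> (\<lambda>y. w y * ?L (hh n) y))" .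
  qed
qed

end

section \<open>The amalgam spaces\<close>

lemma Lq_norm_eq_L_norm: "Lq_norm \<mu> q f = L_norm \<mu> q (\<lambda>x. ennreal (cmod (f x)))"
  by (simp add: Lq_norm_def L_norm_def)

lemma local_norm_eq:
  "local_norm d \<mu> q p \<alpha> r f y =
    ennreal (measure \<mu> (qball d y r) powr (recip \<alpha> - recip p - recip q)) *
    L_norm \<mu> q (\<lambda>x. ennreal (cmod (f x)) * indicator (qball d y r) x)"
proof -
  have "ennreal (cmod (f x * indicator (qball d y r) x)) =
      ennreal (cmod (f x)) * indicator (qball d y r) x" for x
    by (simp split: split_indicator)
  then show ?thesis
    by (simp add: local_norm_def Lq_norm_eq_L_norm)
qed

theorem theorem2p4:
  fixes d :: "'a \<Rightarrow> 'a \<Rightarrow> real" and \<mu> :: "'a measure"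
    and q p \<alpha> :: ennreal and r :: real
  assumes "homogeneous_space d \<mu>"
    and "1 \<le> q" and "q \<le> \<alpha>" and "\<alpha> \<le> p" and "p \<le> \<infinity>"
    and "0 < r"
  shows "complex_banach_space (amalgam_space d \<mu> q p \<alpha> r)
           (\<lambda>F. enn2real (amalgam_class_norm d \<mu> q p \<alpha> r F))"
proof -
  interpret homogeneous_space d \<mu>
    by (rule assms(1))
  have p: "1 \<le> p"
    using assms by simp
  define \<Phi> where "\<Phi> = (if p = \<infinity> then (\<lambda>h. SUP y. h y) else L_norm \<mu> p)"
  define w where "w y = ennreal (measure \<mu> (qball d y r) powr (recip \<alpha> - recip p - recip q))" for y
  define \<rho> where
    "\<rho> = (\<lambda>h. \<Phi> (\<lambda>y. w y * L_norm \<mu> q (\<lambda>x. h x * indicator (qball d y r) x)))"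
  have "function_norm \<mu> \<Phi>"
    using function_norm_SUP[of \<mu>] banach_function_norm_L_norm[OF p, of \<mu>]
    by (auto simp: \<Phi>_def banach_function_norm_def)
  moreover have "w \<in> borel_measurable \<mu>"
    unfolding w_def[abs_def] by measurable
  moreover have "0 < w y" for y
    using emeasure_qball_pos[OF assms(6), of y] emeasure_qball_finite[OF assms(6), of y]
    by (auto simp: w_def measure_def enn2real_eq_0_iff)
  ultimately interpret banach_function_norm \<mu> \<rho>
    unfolding \<rho>_def by (intro banach_function_norm_averages_over_balls assms(2,6))
  have "amalgam_norm d \<mu> q p \<alpha> r = cnorm"
    by (rule ext)
      (simp add: amalgam_norm_def \<rho>_def \<Phi>_def w_def local_norm_eq L_norm_def[of \<mu> p])
  then have "amalgam_class_norm d \<mu> q p \<alpha> r = class_norm"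
    by (simp add: fun_eq_iff amalgam_class_norm_def class_norm_def)
  then show ?thesis
    using complex_banach_space_function_space by (simp add: amalgam_space_def function_space_def)
qed

end
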